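(* Let \[ a:=x_1+x_2-x_1x_2,\qquad b:=x_3+x_4-x_3x_4,\qquad c:=x_1x_2x_3x_4,\] and define \[ P:=ab-c+x_5x_6(1-a)+x_5x_7(1-b)-x_5x_6x_7(1-c)\in\mathbb{Z}[x_1,\dots,x_7].\] Then $P$ is $(7,3)$-admissible.
   Context: Let $[q]=\{1,\dots,q\}$. For $s,q\in\mathbb{N}$ with $s\le q$, consider a multilinear polynomial $P(x_1,\dots,x_q)=\sum_{T\subseteq[q]}c_T\prod_{i\in T}x_i\in\mathbb{Z}[x_1,\dots,x_q]$. $P$ is called Boolean if $P(x_1,\dots,x_q)\in\{0,1\}$ for all $(x_1,\dots,x_q)\in\{0,1\}^q$. A Boolean polynomial $P$ is called $(q,s)$-admissible if all of the following hold: $P(1,\dots,1)=0$; $c_{[q]}>0$; and $s=\max\{|T|: T\subseteq[q],\ c_T<0\}$. *)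

theory Defs
  imports "HOL-Library.Poly_Mapping"
begin

text \<open>
  Integer polynomials in indeterminates \<open>x\<^sub>i\<close> with \<open>i :: nat\<close>: a monomial is its finitely
  supported exponent vector, a polynomial is the finitely supported family of its coefficients.
\<close>

type_synonym int_mpoly = "(nat \<Rightarrow>\<^sub>0 nat) \<Rightarrow>\<^sub>0 int"

definition X :: "nat \<Rightarrow> int_mpoly" where
  "X i = Poly_Mapping.single (Poly_Mapping.single i 1) 1"

definition eval_mpoly :: "int_mpoly \<Rightarrow> (nat \<Rightarrow> int) \<Rightarrow> int" where
  "eval_mpoly P x =
     (\<Sum>m\<in>Poly_Mapping.keys P. Poly_Mapping.lookup P m *
        (\<Prod>i\<in>Poly_Mapping.keys m. x i ^ Poly_Mapping.lookup m i))"

text \<open>\<open>coeff_set P T\<close> is $c_T$, the coefficient of $\prod_{i \in T} x_i$ (for finite \<open>T\<close>).\<close>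

definition coeff_set :: "int_mpoly \<Rightarrow> nat set \<Rightarrow> int" where
  "coeff_set P T = Poly_Mapping.lookup P (\<Sum>i\<in>T. Poly_Mapping.single i 1)"

text \<open>This also forces \<open>P\<close> to involve no indeterminates other than $x_1, \dots, x_q$.\<close>

definition multilinear :: "nat \<Rightarrow> int_mpoly \<Rightarrow> bool" where
  "multilinear q P \<longleftrightarrow>
     (\<exists>c :: nat set \<Rightarrow> int. P = (\<Sum>T\<in>Pow {1..q}. of_int (c T) * (\<Prod>i\<in>T. X i)))"

definition boolean_mpoly :: "nat \<Rightarrow> int_mpoly \<Rightarrow> bool" where
  "boolean_mpoly q P \<longleftrightarrow> multilinear q P \<and>
     (\<forall>x. (\<forall>i\<in>{1..q}. x i \<in> {0, 1}) \<longrightarrow> eval_mpoly P x \<in> {0, 1})"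

text \<open>
  \<open>Max {}\<close> is an unspecified value, so the existence of a negative coefficient, implicit in
  the maximum being \<open>s\<close>, is required explicitly.
\<close>

definition admissible :: "nat \<Rightarrow> nat \<Rightarrow> int_mpoly \<Rightarrow> bool" where
  "admissible q s P \<longleftrightarrow>
     s \<le> q \<and>
     boolean_mpoly q P \<and>
     eval_mpoly P (\<lambda>_. 1) = 0 \<and>
     coeff_set P {1..q} > 0 \<and>
     {T. T \<subseteq> {1..q} \<and> coeff_set P T < 0} \<noteq> {} \<and>
     s = Max {card T | T. T \<subseteq> {1..q} \<and> coeff_set P T < 0}"

end

theory Submission
  imports Defs
begin

text \<open>On 0/1 points \<open>a\<close> is "x1 or x2", \<open>b\<close> is "x3 or x4", and
  \<open>c\<close> is the conjunction of x1, ..., x4, so \<open>c\<close> is at most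
  \<open>a * b\<close>. If x5 = 0 or x6 = x7 = 0, then P = ab - c. If x5 = x6 = 1 and x7 = 0, then P
  = ab - c + 1 - a, which is 1 for a = 0 and b - c for a = 1; the case x7 = 1, x6 = 0 is symmetric.
  If x5 = x6 = x7 = 1, then P = (1 - a)(1 - b). So P is Boolean, and it vanishes at the all-ones
  point, where a = b = c = 1. Expanded, P has nine monomials with coefficient 1, among them the full
  product, and nine with coefficient -1, all of degree 3. The code reads everything off this
  expansion: evaluation and \<open>coeff_set\<close> are additive, and
  \<open>eval_mpoly_prod_X\<close>, \<open>coeff_set_prod_X\<close> and
  \<open>multilinear_prod_X\<close> treat a single squarefree monomial. Booleanity is then checked
  point by point.\<close>

text \<open>Cancellation can make the support of a sum smaller than the union of the supports.
  Summing over a larger finite set lets both summands and their sum share one index set.\<close>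

lemma eval_mpoly_superset:
  assumes "finite A" "Poly_Mapping.keys P \<subseteq> A"
  shows "eval_mpoly P x = (\<Sum>m\<in>A. Poly_Mapping.lookup P m *
    (\<Prod>i\<in>Poly_Mapping.keys m. x i ^ Poly_Mapping.lookup m i))"
  unfolding eval_mpoly_def
  using assms by (intro sum.mono_neutral_left) (auto simp: in_keys_iff)

lemma eval_mpoly_add: "eval_mpoly (P + Q) x = eval_mpoly P x + eval_mpoly Q x"
proof -
  let ?A = "Poly_Mapping.keys P \<union> Poly_Mapping.keys Q"
  have "finite ?A" "Poly_Mapping.keys (P + Q) \<subseteq> ?A"
    by (auto simp: in_keys_iff lookup_add)
  then show ?thesis
    by (simp add: eval_mpoly_superset[of ?A] lookup_add distrib_right sum.distrib)
qed

lemma eval_mpoly_diff: "eval_mpoly (P - Q) x = eval_mpoly P x - eval_mpoly Q x"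
  using eval_mpoly_add[of "P - Q" Q x] by simp

lemma lookup_sum_single_one:
  assumes "finite T"
  shows "Poly_Mapping.lookup (\<Sum>i\<in>T. Poly_Mapping.single i (1::nat)) j = (if j \<in> T then 1 else 0)"
  using assms by (induction T rule: finite_induct) (auto simp: lookup_add lookup_single when_def)

lemma keys_sum_single_one:
  assumes "finite T"
  shows "Poly_Mapping.keys (\<Sum>i\<in>T. Poly_Mapping.single i (1::nat)) = T"
  \<comment> \<open>With \<open>One_nat_def\<close> active, the exponent 1 would become
    \<open>Suc 0\<close> and the lookup lemma would no longer match.\<close>
  using assms by (auto simp: in_keys_iff lookup_sum_single_one simp del: One_nat_def split: if_splits)

lemma prod_X_eq_single:
  assumes "finite T"
  shows "prod X T = Poly_Mapping.single (\<Sum>i\<in>T. Poly_Mapping.single i 1) 1"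
  using assms by (induction T rule: finite_induct) (simp_all add: X_def mult_single)

lemma eval_mpoly_prod_X:
  assumes "finite T"
  shows "eval_mpoly (prod X T) x = prod x T"
  using assms
  by (simp add: prod_X_eq_single eval_mpoly_def keys_sum_single_one lookup_sum_single_one
      del: One_nat_def)

lemma coeff_set_add: "coeff_set (P + Q) T = coeff_set P T + coeff_set Q T"
  by (simp add: coeff_set_def lookup_add)

lemma coeff_set_diff: "coeff_set (P - Q) T = coeff_set P T - coeff_set Q T"
  by (simp add: coeff_set_def lookup_minus)

text \<open>A finite set is recovered as the support of its exponent vector, so distinct sets give
  distinct monomials.\<close>

lemma coeff_set_prod_X:
  assumes "finite T" "finite U"
  shows "coeff_set (prod X U) T = (if T = U then 1 else 0)"
proof -
  have "(\<Sum>i\<in>T. Poly_Mapping.single i (1::nat)) = (\<Sum>i\<in>U. Poly_Mapping.single i 1) \<longleftrightarrow> T = U"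
    using assms keys_sum_single_one by metis
  then show ?thesis
    using assms by (auto simp: coeff_set_def prod_X_eq_single lookup_single when_def simp del: One_nat_def)
qed

lemma multilinear_add:
  assumes "multilinear q P" "multilinear q Q"
  shows "multilinear q (P + Q)"
proof -
  obtain c d where "P = (\<Sum>T\<in>Pow {1..q}. of_int (c T) * prod X T)"
    "Q = (\<Sum>T\<in>Pow {1..q}. of_int (d T) * prod X T)"
    using assms unfolding multilinear_def by blast
  then have "P + Q = (\<Sum>T\<in>Pow {1..q}. of_int (c T + d T) * prod X T)"
    by (simp add: distrib_right sum.distrib)
  then show ?thesis unfolding multilinear_def by (intro exI[of _ "\<lambda>T. c T + d T"])
qed

lemma multilinear_diff:
  assumes "multilinear q P" "multilinear q Q"
  shows "multilinear q (P - Q)"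
proof -
  obtain c d where "P = (\<Sum>T\<in>Pow {1..q}. of_int (c T) * prod X T)"
    "Q = (\<Sum>T\<in>Pow {1..q}. of_int (d T) * prod X T)"
    using assms unfolding multilinear_def by blast
  then have "P - Q = (\<Sum>T\<in>Pow {1..q}. of_int (c T - d T) * prod X T)"
    by (simp add: left_diff_distrib sum_subtractf)
  then show ?thesis unfolding multilinear_def by (intro exI[of _ "\<lambda>T. c T - d T"])
qed

lemma multilinear_prod_X:
  assumes "U \<subseteq> {1..q}"
  shows "multilinear q (prod X U)"
proof -
  have "(\<Sum>T\<in>Pow {1..q}. of_int (if T = U then 1 else 0) * prod X T)
      = (\<Sum>T\<in>Pow {1..q}. if T = U then prod X T else 0)"
    by (intro sum.cong) auto
  also have "\<dots> = prod X U"
    using assms by (simp add: sum.delta)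
  finally show ?thesis unfolding multilinear_def by metis
qed

theorem theorem3p2:
  fixes a b c P :: int_mpoly
  assumes "a = X 1 + X 2 - X 1 * X 2"
    and "b = X 3 + X 4 - X 3 * X 4"
    and "c = X 1 * X 2 * X 3 * X 4"
    and "P = a * b - c + X 5 * X 6 * (1 - a) + X 5 * X 7 * (1 - b) - X 5 * X 6 * X 7 * (1 - c)"
  shows "admissible 7 3 P"
proof -
  \<comment> \<open>The monomial x1x2x3x4 arising from \<open>a * b\<close> is cancelled by
    \<open>c\<close>; otherwise no two terms of the expansion meet.\<close>
  have P: "P =
      prod X {1,3} + prod X {1,4} + prod X {2,3} + prod X {2,4}
      + prod X {5,6} + prod X {5,7}
      + prod X {1,2,5,6} + prod X {3,4,5,7} + prod X {1,2,3,4,5,6,7}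
      - prod X {1,3,4} - prod X {2,3,4} - prod X {1,2,3} - prod X {1,2,4}
      - prod X {1,5,6} - prod X {2,5,6} - prod X {3,5,7} - prod X {4,5,7} - prod X {5,6,7}"
    unfolding assms by (simp add: algebra_simps)
  have ml: "multilinear 7 P"
    unfolding P by (intro multilinear_add multilinear_diff multilinear_prod_X) auto
  have ev: "eval_mpoly P x =
      prod x {1,3} + prod x {1,4} + prod x {2,3} + prod x {2,4}
      + prod x {5,6} + prod x {5,7}
      + prod x {1,2,5,6} + prod x {3,4,5,7} + prod x {1,2,3,4,5,6,7}
      - prod x {1,3,4} - prod x {2,3,4} - prod x {1,2,3} - prod x {1,2,4}
      - prod x {1,5,6} - prod x {2,5,6} - prod x {3,5,7} - prod x {4,5,7} - prod x {5,6,7}" for x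
    unfolding P by (simp only: eval_mpoly_add eval_mpoly_diff eval_mpoly_prod_X
        finite.emptyI finite.insertI)
  have "eval_mpoly P x \<in> {0, 1}" if "\<forall>i\<in>{1..7}. x i \<in> {0, 1}" for x
  proof -
    have "x 1 = 0 \<or> x 1 = 1" "x 2 = 0 \<or> x 2 = 1" "x 3 = 0 \<or> x 3 = 1" "x 4 = 0 \<or> x 4 = 1"
      "x 5 = 0 \<or> x 5 = 1" "x 6 = 0 \<or> x 6 = 1" "x 7 = 0 \<or> x 7 = 1"
      using that by auto
    \<comment> \<open>All 128 points of the cube are checked by direct evaluation.\<close>
    then show ?thesis
      unfolding ev by (elim disjE) simp_all
  qed
  then have bool: "boolean_mpoly 7 P"
    using ml by (simp add: boolean_mpoly_def)
  have coeff: "coeff_set P T =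
      (\<Sum>U\<leftarrow>[{1,3}, {1,4}, {2,3}, {2,4}, {5,6}, {5,7}, {1,2,5,6}, {3,4,5,7}, {1,2,3,4,5,6,7}].
        if T = U then 1 else 0)
      - (\<Sum>U\<leftarrow>[{1,3,4}, {2,3,4}, {1,2,3}, {1,2,4}, {1,5,6}, {2,5,6}, {3,5,7}, {4,5,7}, {5,6,7}].
        if T = U then 1 else 0)" if "finite T" for T
    unfolding P using that
    by (simp only: coeff_set_add coeff_set_diff coeff_set_prod_X finite.emptyI finite.insertI
        list.map sum_list.Cons sum_list.Nil)
  have "{1..7::nat} = {1,2,3,4,5,6,7}"
    by auto
  moreover have "coeff_set P {1,2,3,4,5,6,7} = 1"
    \<comment> \<open>\<open>set_eq_subset\<close> reduces each comparison of explicit sets to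
      membership of numerals, which \<open>simp\<close> decides.\<close>
    by (simp add: coeff set_eq_subset)
  ultimately have top: "coeff_set P {1..7} = 1"
    by simp
  have card_neg: "card T = 3" if "finite T" "coeff_set P T < 0" for T
  proof -
    have "T \<in> {{1,3,4}, {2,3,4}, {1,2,3}, {1,2,4}, {1,5,6}, {2,5,6}, {3,5,7}, {4,5,7}, {5,6,7}}"
    proof (rule ccontr)
      assume "\<not> ?thesis"
      \<comment> \<open>Outside the nine listed sets the subtracted sum is zero, leaving a sum of
        zeros and ones.\<close>
      then have "coeff_set P T \<ge> 0"
        using that(1) by (simp add: coeff)
      with that(2) show False by simp
    qed
    then show ?thesis by (elim insertE) simp_all
  qed
  have neg: "coeff_set P {1,3,4} < 0"
    by (simp add: coeff set_eq_subset)
  have "{card T | T. T \<subseteq> {1..7} \<and> coeff_set P T < 0} = {3}"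
  proof (intro equalityI subsetI)
    fix n assume "n \<in> {card T | T. T \<subseteq> {1..7} \<and> coeff_set P T < 0}"
    then show "n \<in> {3}"
      using card_neg finite_subset[of _ "{1..7::nat}"] by auto
  next
    fix n :: nat assume "n \<in> {3}"
    then show "n \<in> {card T | T. T \<subseteq> {1..7} \<and> coeff_set P T < 0}"
      using neg by (auto intro!: exI[of _ "{1,3,4}"])
  qed
  moreover have "{T. T \<subseteq> {1..7} \<and> coeff_set P T < 0} \<noteq> {}"
    using neg by (auto intro!: exI[of _ "{1,3,4}"])
  moreover have "eval_mpoly P (\<lambda>_. 1) = 0"
    by (simp add: ev)
  ultimately show ?thesis
    using bool top by (simp add: admissible_def)
qed

end
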